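(* Let $\mathcal{A}$ be a weakly ordered architecture and let $\varphi$ be a syntactically safe LTL formula over $I\cup O$. Then $\varphi$ is unrealizable in $\mathcal{A}$ if and only if there exists a finite counterexample for $\varphi$ in $\mathcal{A}$.
   Context: Architectures. $\mathcal{A}=(P,p_{env},\{I_p\}_{p\in P},\{O_p\}_{p\in P})$ with $P$ a finite set of processes, $p_{env}\notin P$ the environment, $I_p,O_p$ subsets of a finite variable set $V$, $O_p\cap O_{p'}=\emptyset$ for $p\ne p'$; $I=\bigcup_pI_p$, $O=\bigcup_pO_p$, $I_{env}=I\setminus O$, and set $O_{p_{env}}:=I_{env}$. The graph of $\mathcal{A}$ has vertices $P\cup\{p_{env}\}$ and an edge $(q,p)$ labeled $O_q\cap I_p$ whenever this set is nonempty. An information fork is a tuple $(P',V',p,p')$ with $P'\subseteq P\cup\{p_{env}\}$, $V'\subseteq V$ disjoint from $I_p\cup I_{p'}$, and distinct $p,p'\in P\setminus P'$, such that $P'$ together with the edges labeled with at least one variable of $V'$ forms a subgraph rooted in $p_{env}$, and there exist $q,q'\in P'$ with edges to $p$ and $p'$ respectively whose labels are incomparable under $\subseteq$. $\mathcal{A}$ is weakly ordered if it contains no information fork. An implementation of $p$ is $f_p:(2^{I_p})^*\to2^{O_p}$ (finite-state if representable by a finite transducer). For implementations $(f_p)_p$ and $\sigma\in(2^{I_{env}})^\omega$ the induced run is the unique $w\in(2^{I\cup O})^\omega$ with $w_t\cap I_{env}=\sigma_t$ and $w_t\cap O_p=f_p((w_0\cap I_p)\cdots(w_{t-1}\cap I_p))$.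 $\varphi$ is realizable in $\mathcal{A}$ if some finite-state implementations make the induced run of every $\sigma$ satisfy $\varphi$. A finite counterexample for $\varphi$ in $\mathcal{A}$ is a finite set $\mathcal{P}\subseteq(2^{I_{env}})^\omega$ such that for every choice of implementations $(f_p)_p$ some $\sigma\in\mathcal{P}$ has an induced run violating $\varphi$. Syntactically safe LTL formulas are generated by $\varphi::=x\mid\neg x\mid\varphi\vee\varphi\mid\varphi\wedge\varphi\mid\mathsf{X}\varphi\mid\mathsf{G}\varphi\mid\varphi\,\mathsf{R}\,\varphi$. *)

theory Defs
  imports "HOL-Library.Omega_Words_Fun" "HOL-Library.FuncSet"
begin

section \<open>Architectures\<close>

record ('p, 'v) arch =
  procs :: "'p set"
  env :: 'p
  vars :: "'v set"
  inp :: "'p \<Rightarrow> 'v set"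
  outp :: "'p \<Rightarrow> 'v set"

text \<open>
  The fields \<open>inp\<close> and \<open>outp\<close> are meaningful only on \<open>procs\<close>; their values at
  \<open>env\<close> (and at all other points) are never used.
\<close>

locale architecture =
  fixes A :: "('p, 'v) arch"
  assumes finite_procs: "finite (procs A)"
    and env_not_proc: "env A \<notin> procs A"
    and finite_vars: "finite (vars A)"
    and inp_vars: "p \<in> procs A \<Longrightarrow> inp A p \<subseteq> vars A"
    and outp_vars: "p \<in> procs A \<Longrightarrow> outp A p \<subseteq> vars A"
    and outp_disjoint: "p \<in> procs A \<Longrightarrow> q \<in> procs A \<Longrightarrow> p \<noteq> q \<Longrightarrow> outp A p \<inter> outp A q = {}"

definition all_inp :: "('p, 'v) arch \<Rightarrow> 'v set" where
  "all_inp A = (\<Union>p\<in>procs A. inp A p)"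

definition all_outp :: "('p, 'v) arch \<Rightarrow> 'v set" where
  "all_outp A = (\<Union>p\<in>procs A. outp A p)"

definition env_vars :: "('p, 'v) arch \<Rightarrow> 'v set" where
  "env_vars A = all_inp A - all_outp A"

definition node_outp :: "('p, 'v) arch \<Rightarrow> 'p \<Rightarrow> 'v set" where
  "node_outp A q = (if q = env A then env_vars A else outp A q)"

definition nodes :: "('p, 'v) arch \<Rightarrow> 'p set" where
  "nodes A = insert (env A) (procs A)"

definition label :: "('p, 'v) arch \<Rightarrow> 'p \<Rightarrow> 'p \<Rightarrow> 'v set" where
  "label A q p = node_outp A q \<inter> inp A p"

text \<open>The environment has no inputs, hence no incoming edges.\<close>

definition edges :: "('p, 'v) arch \<Rightarrow> ('p \<times> 'p) set" where
  "edges A = {(q, p). q \<in> nodes A \<and> p \<in> procs A \<and> label A q p \<noteq> {}}"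

text \<open>
  The graph with vertex set \<open>W\<close>, and with those edges in \<open>E\<close> that run between vertices
  in \<open>W\<close>, is rooted in \<open>r\<close>.
\<close>

definition rooted_in :: "'p \<Rightarrow> 'p set \<Rightarrow> ('p \<times> 'p) set \<Rightarrow> bool" where
  "rooted_in r W E \<longleftrightarrow> r \<in> W \<and> (\<forall>v\<in>W. (r, v) \<in> (E \<inter> W \<times> W)\<^sup>*)"

definition information_fork :: "('p, 'v) arch \<Rightarrow> 'p set \<Rightarrow> 'v set \<Rightarrow> 'p \<Rightarrow> 'p \<Rightarrow> bool" where
  "information_fork A P' V' p p' \<longleftrightarrow>
     P' \<subseteq> nodes A \<and>
     V' \<subseteq> vars A \<and> V' \<inter> (inp A p \<union> inp A p') = {} \<and>
     p \<in> procs A - P' \<and> p' \<in> procs A - P' \<and> p \<noteq> p' \<and>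
     rooted_in (env A) P' {(q, r) \<in> edges A. label A q r \<inter> V' \<noteq> {}} \<and>
     (\<exists>q\<in>P'. \<exists>q'\<in>P'. (q, p) \<in> edges A \<and> (q', p') \<in> edges A \<and>
        \<not> label A q p \<subseteq> label A q' p' \<and> \<not> label A q' p' \<subseteq> label A q p)"

definition weakly_ordered :: "('p, 'v) arch \<Rightarrow> bool" where
  "weakly_ordered A \<longleftrightarrow> \<not> (\<exists>P' V' p p'. information_fork A P' V' p p')"


section \<open>Implementations and induced runs\<close>

type_synonym ('p, 'v) impl = "'p \<Rightarrow> 'v set list \<Rightarrow> 'v set"

text \<open>
  Only the values of \<open>f p\<close> for \<open>p \<in> procs A\<close> on words over \<open>Pow (inp A p)\<close> matter.
\<close>

definition implementations :: "('p, 'v) arch \<Rightarrow> ('p, 'v) impl set" where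
  "implementations A = {f. \<forall>p\<in>procs A. f p \<in> lists (Pow (inp A p)) \<rightarrow> Pow (outp A p)}"

text \<open>
  Representability by a finite deterministic transducer whose output depends on the state
  reached after reading the history. Taking states in \<open>nat\<close> loses no generality.
\<close>

definition finite_state :: "'v set \<Rightarrow> ('v set list \<Rightarrow> 'v set) \<Rightarrow> bool" where
  "finite_state J g \<longleftrightarrow>
     (\<exists>(S :: nat set) s0 \<delta> out. finite S \<and> s0 \<in> S \<and> \<delta> \<in> S \<rightarrow> Pow J \<rightarrow> S \<and>
        (\<forall>h\<in>lists (Pow J). g h = out (foldl \<delta> s0 h)))"

definition env_words :: "('p, 'v) arch \<Rightarrow> 'v set word set" where
  "env_words A = {\<sigma>. \<forall>t. \<sigma> t \<subseteq> env_vars A}"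

definition is_induced_run ::
    "('p, 'v) arch \<Rightarrow> ('p, 'v) impl \<Rightarrow> 'v set word \<Rightarrow> 'v set word \<Rightarrow> bool" where
  "is_induced_run A f \<sigma> w \<longleftrightarrow>
     (\<forall>t. w t \<subseteq> all_inp A \<union> all_outp A \<and> w t \<inter> env_vars A = \<sigma> t \<and>
       (\<forall>p\<in>procs A. w t \<inter> outp A p = f p (map (\<lambda>a. a \<inter> inp A p) (prefix t w))))"

definition induced_run ::
    "('p, 'v) arch \<Rightarrow> ('p, 'v) impl \<Rightarrow> 'v set word \<Rightarrow> 'v set word" where
  "induced_run A f \<sigma> = (THE w. is_induced_run A f \<sigma> w)"

text \<open>For well-formed arguments the definite description above denotes a unique word; the lemma below proves this by building the run step by step.\<close>

primrec run_prefix ::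
    "('p, 'v) arch \<Rightarrow> ('p, 'v) impl \<Rightarrow> 'v set word \<Rightarrow> nat \<Rightarrow> 'v set list" where
  "run_prefix A f \<sigma> 0 = []"
| "run_prefix A f \<sigma> (Suc t) = run_prefix A f \<sigma> t @
     [\<sigma> t \<union> (\<Union>p\<in>procs A. f p (map (\<lambda>a. a \<inter> inp A p) (run_prefix A f \<sigma> t)))]"

lemma (in architecture) ex1_induced_run:
  assumes f: "f \<in> implementations A" and \<sigma>: "\<sigma> \<in> env_words A"
  shows "\<exists>!w. is_induced_run A f \<sigma> w"
proof (rule ex_ex1I)
  define g where "g t p = f p (map (\<lambda>a. a \<inter> inp A p) (run_prefix A f \<sigma> t))" for t p
  define w where "w t = \<sigma> t \<union> (\<Union>p\<in>procs A. g t p)" for t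
  have pre: "prefix t w = run_prefix A f \<sigma> t" for t
    by (induction t) (simp_all add: subsequence_def w_def g_def)
  have sub: "g t p \<subseteq> outp A p" if "p \<in> procs A" for t p
  proof -
    let ?h = "map (\<lambda>a. a \<inter> inp A p) (run_prefix A f \<sigma> t)"
    have "?h \<in> lists (Pow (inp A p))"
      unfolding lists_eq_set by auto
    moreover have "f p \<in> lists (Pow (inp A p)) \<rightarrow> Pow (outp A p)"
      using f that by (simp add: implementations_def)
    ultimately have "f p ?h \<in> Pow (outp A p)"
      by (rule funcset_mem[rotated])
    then show ?thesis
      by (simp add: g_def)
  qed
  have \<sigma>t: "\<sigma> t \<subseteq> env_vars A" for t
    using \<sigma> by (simp add: env_words_def)
  have out: "w t \<inter> outp A p = g t p" if p: "p \<in> procs A" for t p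
  proof -
    have "\<sigma> t \<inter> outp A p = {}"
      using \<sigma>t[of t] p by (auto simp: env_vars_def all_outp_def)
    moreover have "g t q \<inter> outp A p = {}" if "q \<in> procs A" "q \<noteq> p" for q
      using sub[OF that(1), of t] outp_disjoint[OF that(1) p that(2)] by blast
    ultimately show ?thesis
      using sub[OF p, of t] p unfolding w_def by fast
  qed
  have gsub: "(\<Union>p\<in>procs A. g t p) \<subseteq> all_outp A" for t
    unfolding all_outp_def using sub by (intro UN_mono) auto
  have "w t \<inter> env_vars A = \<sigma> t" for t
    using \<sigma>t[of t] gsub[of t] unfolding w_def env_vars_def by auto
  moreover have "w t \<subseteq> all_inp A \<union> all_outp A" for t
    using \<sigma>t[of t] gsub[of t] unfolding w_def env_vars_def by auto
  ultimately have "is_induced_run A f \<sigma> w"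
    by (simp add: is_induced_run_def pre out flip: g_def)
  then show "\<exists>w. is_induced_run A f \<sigma> w"
    by blast
next
  fix w w' assume w: "is_induced_run A f \<sigma> w" and w': "is_induced_run A f \<sigma> w'"
  have "w t = w' t" for t
  proof (induction t rule: less_induct)
    case (less t)
    have eq: "prefix t w = prefix t w'"
      unfolding subsequence_def using less.IH by (intro map_cong refl) simp
    have e: "w t \<inter> env_vars A = w' t \<inter> env_vars A"
      using w w' by (simp add: is_induced_run_def)
    have o: "w t \<inter> outp A p = w' t \<inter> outp A p" if "p \<in> procs A" for p
      using w w' that by (simp add: is_induced_run_def eq)
    have decomp: "v = (v \<inter> env_vars A) \<union> (\<Union>p\<in>procs A. v \<inter> outp A p)"
      if "v \<subseteq> all_inp A \<union> all_outp A" for v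
      using that by (auto simp: env_vars_def all_outp_def)
    have "w t = (w t \<inter> env_vars A) \<union> (\<Union>p\<in>procs A. w t \<inter> outp A p)"
      by (rule decomp) (use w in \<open>simp add: is_induced_run_def\<close>)
    also have "\<dots> = (w' t \<inter> env_vars A) \<union> (\<Union>p\<in>procs A. w' t \<inter> outp A p)"
      by (rule arg_cong2[where f = "(\<union>)"], rule e, rule SUP_cong[OF refl], erule o)
    also have "\<dots> = w' t"
      by (rule decomp[symmetric]) (use w' in \<open>simp add: is_induced_run_def\<close>)
    finally show ?case .
  qed
  then show "w = w'" by blast
qed


section \<open>Syntactically safe LTL\<close>

datatype (atoms: 'v) safe_ltl =
    Atom 'v
  | NegAtom 'v
  | Or "'v safe_ltl" "'v safe_ltl"
  | And "'v safe_ltl" "'v safe_ltl"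
  | Next "'v safe_ltl"
  | Globally "'v safe_ltl"
  | Release "'v safe_ltl" "'v safe_ltl"

primrec sat :: "'v set word \<Rightarrow> 'v safe_ltl \<Rightarrow> bool" (infix \<open>\<Turnstile>\<close> 50) where
  "w \<Turnstile> Atom x \<longleftrightarrow> x \<in> w 0"
| "w \<Turnstile> NegAtom x \<longleftrightarrow> x \<notin> w 0"
| "w \<Turnstile> Or \<phi> \<psi> \<longleftrightarrow> w \<Turnstile> \<phi> \<or> w \<Turnstile> \<psi>"
| "w \<Turnstile> And \<phi> \<psi> \<longleftrightarrow> w \<Turnstile> \<phi> \<and> w \<Turnstile> \<psi>"
| "w \<Turnstile> Next \<phi> \<longleftrightarrow> suffix 1 w \<Turnstile> \<phi>"
| "w \<Turnstile> Globally \<phi> \<longleftrightarrow> (\<forall>k. suffix k w \<Turnstile> \<phi>)"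
| "w \<Turnstile> Release \<phi> \<psi> \<longleftrightarrow> (\<forall>k. suffix k w \<Turnstile> \<psi> \<or> (\<exists>j<k. suffix j w \<Turnstile> \<phi>))"


section \<open>Realizability and finite counterexamples\<close>

definition realizable :: "('p, 'v) arch \<Rightarrow> 'v safe_ltl \<Rightarrow> bool" where
  "realizable A \<phi> \<longleftrightarrow>
     (\<exists>f\<in>implementations A. (\<forall>p\<in>procs A. finite_state (inp A p) (f p)) \<and>
        (\<forall>\<sigma>\<in>env_words A. induced_run A f \<sigma> \<Turnstile> \<phi>))"

definition finite_counterexample ::
    "('p, 'v) arch \<Rightarrow> 'v safe_ltl \<Rightarrow> 'v set word set \<Rightarrow> bool" where
  "finite_counterexample A \<phi> C \<longleftrightarrow>
     finite C \<and> C \<subseteq> env_words A \<and>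
     (\<forall>f\<in>implementations A. \<exists>\<sigma>\<in>C. \<not> induced_run A f \<sigma> \<Turnstile> \<phi>)"

end

theory Submission
  imports Defs "HOL-Library.Nat_Bijection"
begin

text \<open>
  If no finite set of environment words refutes all implementations, compactness yields a
  possibly infinite-state implementation \<open>f\<close> all of whose runs satisfy the formula. Without
  information forks the processes form a chain: the observations of a better informed process
  determine, for this fixed \<open>f\<close>, those of a worse informed one. Histories are classified by the
  residual of the formula, then by the set of residuals that the best informed process considers
  possible, then by the set of such sets for the next process, and so on. There are finitely many
  classes at every level. A process only has to remember one representative observation for its
  own class and the classes of all processes below it, and to play what \<open>f\<close> plays there.
\<close>

section \<open>Residuals of safe LTL formulas\<close>

text \<open>The left quotient of the language of \<open>\<phi>\<close> by \<open>u\<close>; equality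
  of residuals is Myhill-Nerode equivalence.\<close>

definition residual :: "'v safe_ltl \<Rightarrow> 'v set list \<Rightarrow> 'v set word set" where
  "residual \<phi> u = {w. u \<frown> w \<Turnstile> \<phi>}"

lemma residual_append: "residual \<phi> (u @ v) = {w. v \<frown> w \<in> residual \<phi> u}"
  by (simp add: residual_def)

lemma residual_Globally:
  "residual (Globally \<phi>) u =
     residual (Globally \<phi>) [] \<inter> (\<Inter>k<length u. residual \<phi> (drop k u))"
proof -
  have "(\<forall>k. suffix k (u \<frown> w) \<Turnstile> \<phi>) \<longleftrightarrow>
      (\<forall>k. suffix k w \<Turnstile> \<phi>) \<and> (\<forall>k<length u. drop k u \<frown> w \<Turnstile> \<phi>)" (is "?l \<longleftrightarrow> ?r") for w
  proof
    assume l: ?l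
    have "suffix k w \<Turnstile> \<phi>" for k
      using spec[OF l, of "length u + k"] by simp
    moreover have "drop k u \<frown> w \<Turnstile> \<phi>" if "k < length u" for k
      using spec[OF l, of k] that by simp
    ultimately show ?r by blast
  next
    assume r: ?r
    show ?l
    proof
      fix k
      show "suffix k (u \<frown> w) \<Turnstile> \<phi>"
        using r by (cases "k < length u") simp_all
    qed
  qed
  then show ?thesis
    by (auto simp: residual_def)
qed

text \<open>The first factor handles the positions from \<open>length u\<close> on, which a
  \<open>\<phi>\<close> inside \<open>u\<close> may already have released; the second handles the
  positions inside \<open>u\<close>.\<close>

lemma residual_Release:
  "residual (Release \<phi> \<psi>) u =
     (residual (Release \<phi> \<psi>) [] \<union> (\<Union>j<length u. residual \<phi> (drop j u))) \<inter>
     (\<Inter>k<length u. residual \<psi> (drop k u) \<union> (\<Union>j<k. residual \<phi> (drop j u)))"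
proof -
  have "u \<frown> w \<Turnstile> Release \<phi> \<psi> \<longleftrightarrow>
      (w \<Turnstile> Release \<phi> \<psi> \<or> (\<exists>j<length u. drop j u \<frown> w \<Turnstile> \<phi>)) \<and>
      (\<forall>k<length u. drop k u \<frown> w \<Turnstile> \<psi> \<or> (\<exists>j<k. drop j u \<frown> w \<Turnstile> \<phi>))"
    (is "?l \<longleftrightarrow> ?r1 \<and> ?r2") for w
  proof
    assume l: ?l
    have ?r2
    proof (intro allI impI)
      fix k assume k: "k < length u"
      have "suffix k (u \<frown> w) \<Turnstile> \<psi> \<or> (\<exists>j<k. suffix j (u \<frown> w) \<Turnstile> \<phi>)"
        using l by simp
      then show "drop k u \<frown> w \<Turnstile> \<psi> \<or> (\<exists>j<k. drop j u \<frown> w \<Turnstile> \<phi>)"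
        using k by (metis less_imp_le less_trans suffix_conc_fst)
    qed
    moreover have ?r1
    proof (cases "\<exists>j<length u. drop j u \<frown> w \<Turnstile> \<phi>")
      case False
      have "suffix k w \<Turnstile> \<psi> \<or> (\<exists>j<k. suffix j w \<Turnstile> \<phi>)" for k
      proof -
        have "suffix (length u + k) (u \<frown> w) \<Turnstile> \<psi> \<or>
            (\<exists>j<length u + k. suffix j (u \<frown> w) \<Turnstile> \<phi>)"
          using l by (simp del: suffix_conc_snd)
        then consider "suffix k w \<Turnstile> \<psi>"
          | j where "j < length u + k" "suffix j (u \<frown> w) \<Turnstile> \<phi>"
          by auto
        then show ?thesis
        proof cases
          case (2 j)
          with False have "\<not> j < length u"
            by (metis less_imp_le suffix_conc_fst)
          with 2 have "j - length u < k" "suffix (j - length u) w \<Turnstile> \<phi>"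
            by simp_all
          then show ?thesis by blast
        qed blast
      qed
      then show ?thesis by simp
    qed simp
    ultimately show "?r1 \<and> ?r2" by blast
  next
    assume r: "?r1 \<and> ?r2"
    have "suffix k (u \<frown> w) \<Turnstile> \<psi> \<or> (\<exists>j<k. suffix j (u \<frown> w) \<Turnstile> \<phi>)" for k
    proof (cases "k < length u")
      case True
      then show ?thesis
        using r by (metis less_imp_le less_trans suffix_conc_fst)
    next
      case False
      then have k: "suffix k (u \<frown> w) = suffix (k - length u) w"
        by simp
      consider "suffix (k - length u) w \<Turnstile> \<psi>"
        | j where "j < k - length u" "suffix j w \<Turnstile> \<phi>"
        | j where "j < length u" "drop j u \<frown> w \<Turnstile> \<phi>"
        using r by (metis sat.simps(7))
      then show ?thesis
      proof cases
        case (2 j)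
        then have "j + length u < k" "suffix (j + length u) (u \<frown> w) \<Turnstile> \<phi>"
          by simp_all
        then show ?thesis by blast
      next
        case (3 j)
        then have "j < k" "suffix j (u \<frown> w) \<Turnstile> \<phi>"
          using False by simp_all
        then show ?thesis by blast
      qed (simp add: k)
    qed
    then show ?l by simp
  qed
  then show ?thesis
    by (auto simp: residual_def simp del: sat.simps)
qed

text \<open>By induction on the formula: beyond the empty word, residuals of a literal are trivial.
  A residual of a compound formula is built by unions and intersections from residuals of its parts
  and at most one fixed set, so finitely many arise.\<close>

lemma finite_residuals: "finite (range (residual \<phi>))"
proof (induction \<phi>)
  case (Atom x)
  have "residual (Atom x) u \<in> {residual (Atom x) [], UNIV, {}}" for u
    by (cases u) (auto simp: residual_def)
  then have "range (residual (Atom x)) \<subseteq> {residual (Atom x) [], UNIV, {}}"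
    by (rule image_subsetI)
  then show ?case
    by (rule finite_subset) simp
next
  case (NegAtom x)
  have "residual (NegAtom x) u \<in> {residual (NegAtom x) [], UNIV, {}}" for u
    by (cases u) (auto simp: residual_def)
  then have "range (residual (NegAtom x)) \<subseteq> {residual (NegAtom x) [], UNIV, {}}"
    by (rule image_subsetI)
  then show ?case
    by (rule finite_subset) simp
next
  case (Or \<phi> \<psi>)
  have "residual (Or \<phi> \<psi>) u = residual \<phi> u \<union> residual \<psi> u" for u
    by (auto simp: residual_def)
  then have "range (residual (Or \<phi> \<psi>)) \<subseteq>
      (\<lambda>(X, Y). X \<union> Y) ` (range (residual \<phi>) \<times> range (residual \<psi>))"
    by auto
  then show ?case
    by (rule finite_subset) (use Or in auto)
next
  case (And \<phi> \<psi>)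
  have "residual (And \<phi> \<psi>) u = residual \<phi> u \<inter> residual \<psi> u" for u
    by (auto simp: residual_def)
  then have "range (residual (And \<phi> \<psi>)) \<subseteq>
      (\<lambda>(X, Y). X \<inter> Y) ` (range (residual \<phi>) \<times> range (residual \<psi>))"
    by auto
  then show ?case
    by (rule finite_subset) (use And in auto)
next
  case (Next \<phi>)
  have "residual (Next \<phi>) u \<in> insert (residual (Next \<phi>) []) (range (residual \<phi>))" for u
  proof (cases u)
    case (Cons a v)
    then have "residual (Next \<phi>) u = residual \<phi> v"
      by (simp add: residual_def suffix_def)
    then show ?thesis by simp
  qed simp
  then have "range (residual (Next \<phi>)) \<subseteq> insert (residual (Next \<phi>) []) (range (residual \<phi>))"
    by blast
  then show ?case
    by (rule finite_subset) (use Next in simp)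
next
  case (Globally \<phi>)
  have "residual (Globally \<phi>) u \<in>
      (\<lambda>X. residual (Globally \<phi>) [] \<inter> \<Inter>X) ` Pow (range (residual \<phi>))" for u
    by (rule image_eqI[where x = "(\<lambda>k. residual \<phi> (drop k u)) ` {..<length u}"])
      (rule residual_Globally, blast)
  then have "range (residual (Globally \<phi>)) \<subseteq>
      (\<lambda>X. residual (Globally \<phi>) [] \<inter> \<Inter>X) ` Pow (range (residual \<phi>))"
    by (rule image_subsetI)
  then show ?case
    by (rule finite_subset) (use Globally in simp)
next
  case (Release \<phi> \<psi>)
  let ?A = "range (residual \<phi>)" and ?B = "range (residual \<psi>)"
  \<comment> \<open>\<open>?M\<close> holds all possible factors of the intersection over
    \<open>k\<close>: each is one residual of \<open>\<psi>\<close> joined with a set of residuals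
    of \<open>\<phi>\<close>, so \<open>?M\<close> is finite.\<close>
  let ?M = "(\<lambda>(b, X). b \<union> \<Union>X) ` (?B \<times> Pow ?A)"
  have "residual (Release \<phi> \<psi>) u \<in>
      (\<lambda>(X, Y). (residual (Release \<phi> \<psi>) [] \<union> \<Union>X) \<inter> \<Inter>Y) ` (Pow ?A \<times> Pow ?M)" for u
  proof (rule image_eqI)
    let ?X = "(\<lambda>j. residual \<phi> (drop j u)) ` {..<length u}"
    let ?Y = "(\<lambda>k. residual \<psi> (drop k u) \<union> (\<Union>j<k. residual \<phi> (drop j u))) ` {..<length u}"
    show "residual (Release \<phi> \<psi>) u =
        (\<lambda>(X, Y). (residual (Release \<phi> \<psi>) [] \<union> \<Union>X) \<inter> \<Inter>Y) (?X, ?Y)"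
      unfolding prod.case by (rule residual_Release)
    have "?Y \<subseteq> ?M"
    proof (rule image_subsetI)
      fix k
      have "(\<lambda>j. residual \<phi> (drop j u)) ` {..<k} \<subseteq> ?A"
        by blast
      then show "residual \<psi> (drop k u) \<union> (\<Union>j<k. residual \<phi> (drop j u)) \<in> ?M"
        by (intro image_eqI[where x = "(residual \<psi> (drop k u), (\<lambda>j. residual \<phi> (drop j u)) ` {..<k})"])
          simp_all
    qed
    moreover have "?X \<subseteq> ?A"
      by blast
    ultimately show "(?X, ?Y) \<in> Pow ?A \<times> Pow ?M"
      by (intro SigmaI PowI)
  qed
  then have "range (residual (Release \<phi> \<psi>)) \<subseteq>
      (\<lambda>(X, Y). (residual (Release \<phi> \<psi>) [] \<union> \<Union>X) \<inter> \<Inter>Y) ` (Pow ?A \<times> Pow ?M)"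
    by (rule image_subsetI)
  then show ?case
    by (rule finite_subset) (use Release in simp)
qed

section \<open>Finite bad prefixes\<close>

text \<open>A violation is witnessed by finitely many positions: one for \<open>Globally\<close>,
  and for \<open>Release\<close> a position where \<open>\<psi>\<close> fails together with all
  earlier ones, where \<open>\<phi>\<close> fails. The bounds for these can be combined.\<close>

lemma safe_ltl_bad_prefix:
  "\<not> w \<Turnstile> \<phi> \<Longrightarrow> \<exists>n. \<forall>w'. (\<forall>i<n. w' i = w i) \<longrightarrow> \<not> w' \<Turnstile> \<phi>"
proof (induction \<phi> arbitrary: w)
  case (Atom x)
  then show ?case by (intro exI[of _ 1]) auto
next
  case (NegAtom x)
  then show ?case by (intro exI[of _ 1]) auto
next
  case (Or \<phi> \<psi>)
  then obtain m n where
    "\<forall>w'. (\<forall>i<m. w' i = w i) \<longrightarrow> \<not> w' \<Turnstile> \<phi>" "\<forall>w'. (\<forall>i<n. w' i = w i) \<longrightarrow> \<not> w' \<Turnstile> \<psi>"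
    by (metis sat.simps(3))
  then show ?case
    by (intro exI[of _ "m + n"]) simp
next
  case (And \<phi> \<psi>)
  then show ?case by (metis sat.simps(4))
next
  case (Next \<phi>)
  then obtain n where n: "\<forall>w'. (\<forall>i<n. w' i = suffix 1 w i) \<longrightarrow> \<not> w' \<Turnstile> \<phi>"
    unfolding sat.simps by blast
  have "\<not> w' \<Turnstile> Next \<phi>" if "\<forall>i<Suc n. w' i = w i" for w'
    using n[rule_format, of "suffix 1 w'"] that by simp
  then show ?case by blast
next
  case (Globally \<phi>)
  then obtain k where "\<not> suffix k w \<Turnstile> \<phi>"
    by auto
  from Globally.IH[OF this] obtain n where
    n: "\<forall>w'. (\<forall>i<n. w' i = suffix k w i) \<longrightarrow> \<not> w' \<Turnstile> \<phi>"
    by blast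
  have "\<not> w' \<Turnstile> Globally \<phi>" if "\<forall>i<k + n. w' i = w i" for w'
    using n[rule_format, of "suffix k w'"] that by auto
  then show ?case by blast
next
  case (Release \<phi> \<psi>)
  then obtain k where k: "\<not> suffix k w \<Turnstile> \<psi>" "\<forall>j<k. \<not> suffix j w \<Turnstile> \<phi>"
    by auto
  obtain n where n: "\<forall>w'. (\<forall>i<n. w' i = suffix k w i) \<longrightarrow> \<not> w' \<Turnstile> \<psi>"
    using Release.IH(2)[OF k(1)] by blast
  have "\<forall>j\<in>{..<k}. \<exists>m. \<forall>w'. (\<forall>i<m. w' i = suffix j w i) \<longrightarrow> \<not> w' \<Turnstile> \<phi>"
    using Release.IH(1) k(2) by blast
  then obtain m where
    m: "\<forall>j\<in>{..<k}. \<forall>w'. (\<forall>i<m j. w' i = suffix j w i) \<longrightarrow> \<not> w' \<Turnstile> \<phi>"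
    by metis
  \<comment> \<open>The sum bounds every \<open>m j\<close> and, unlike a maximum, needs no separate
    treatment of \<open>k = 0\<close>.\<close>
  define M where "M = (\<Sum>j<k. m j)"
  have M: "m j \<le> M" if "j < k" for j
    unfolding M_def using that by (intro member_le_sum) auto
  have "\<not> w' \<Turnstile> Release \<phi> \<psi>" if w': "\<forall>i<k + n + M. w' i = w i" for w'
  proof -
    have "\<not> suffix k w' \<Turnstile> \<psi>"
      using n[rule_format, of "suffix k w'"] w' by simp
    moreover have "\<not> suffix j w' \<Turnstile> \<phi>" if "j < k" for j
      using m[rule_format, of j "suffix j w'"] M[OF that] w' that by simp
    ultimately show ?thesis by auto
  qed
  then show ?case by blast
qed

text \<open>A bad prefix would have an empty residual. Satisfaction thus becomes a condition on
  finite prefixes.\<close>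

lemma sat_if_residuals_nonempty:
  assumes "\<And>n. residual \<phi> (prefix n w) \<noteq> {}"
  shows "w \<Turnstile> \<phi>"
proof (rule ccontr)
  assume "\<not> w \<Turnstile> \<phi>"
  then obtain n where n: "\<forall>w'. (\<forall>i<n. w' i = w i) \<longrightarrow> \<not> w' \<Turnstile> \<phi>"
    using safe_ltl_bad_prefix by blast
  obtain w' where "prefix n w \<frown> w' \<Turnstile> \<phi>"
    using assms[of n] by (auto simp: residual_def)
  moreover have "\<forall>i<n. (prefix n w \<frown> w') i = w i"
    by (simp add: conc_def)
  ultimately show False
    using n by blast
qed

lemma residual_prefix_nonempty:
  assumes "w \<Turnstile> \<phi>"
  shows "residual \<phi> (prefix n w) \<noteq> {}"
proof -
  have "suffix n w \<in> residual \<phi> (prefix n w)"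
    using assms by (simp add: residual_def)
  then show ?thesis by blast
qed


section \<open>Finite collapse of a chain of views\<close>

text \<open>Insertion sort for a relation that need not be antisymmetric, since two processes may be
  equally informed. The new element \<open>a\<close> goes behind exactly those \<open>x\<close> with
  \<open>R x a\<close>.\<close>

lemma ex_sorted_wrt_list:
  assumes "finite P" "transp_on P R" "totalp_on P R"
  shows "\<exists>xs. distinct xs \<and> set xs = P \<and> sorted_wrt R xs"
  using assms
proof (induction P rule: finite_induct)
  case (insert a P)
  then obtain xs where xs: "distinct xs" "set xs = P" "sorted_wrt R xs"
    by (metis subset_insertI totalp_on_subset transp_on_subset)
  let ?ys = "filter (\<lambda>x. R x a) xs @ a # filter (\<lambda>x. \<not> R x a) xs"
  have R: "R a y" if "y \<in> P" "\<not> R y a" for y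
    using insert.prems(2) insert.hyps(2) that by (metis insertCI totalp_onD)
  have "sorted_wrt R ?ys"
    using xs(2,3) R insert.prems(1) by (auto simp: sorted_wrt_append sorted_wrt_filter dest: transp_onD)
  moreover have "distinct ?ys" "set ?ys = insert a P"
    using xs insert.hyps(2) by auto
  ultimately show ?case by blast
qed simp

text \<open>
  The colour \<open>s\<close> of a history is lifted to the set of colours of all histories that look the
  same to the best informed observer; \<open>set_encode\<close> keeps these sets in type \<open>nat\<close>, so that
  the lifting can be iterated along the chain. Representatives are then chosen in the
  opposite direction, starting from the least informed observer.
\<close>

lemma collapse_views:
  fixes V :: "'p \<Rightarrow> 'h \<Rightarrow> 'o" and s :: "'h \<Rightarrow> nat"
  assumes "sorted_wrt (\<lambda>p q. \<forall>h\<in>H. \<forall>k\<in>H. V p h = V p k \<longrightarrow> V q h = V q k) ps"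
    and "distinct ps" and "finite (s ` H)"
  shows "\<exists>N0 N. (\<forall>h\<in>H. N0 h \<in> H \<and> s (N0 h) = s h) \<and> finite (N0 ` H) \<and>
    (\<forall>h\<in>H. \<forall>k\<in>H. s h = s k \<longrightarrow> (\<forall>p\<in>set ps. V p h = V p k) \<longrightarrow> N0 h = N0 k) \<and>
    (\<forall>p\<in>set ps. finite (N p ` H) \<and> (\<forall>h\<in>H. N p h \<in> H \<and> V p (N0 h) = V p (N p h)) \<and>
       (\<forall>h\<in>H. \<forall>k\<in>H. V p h = V p k \<longrightarrow> N p h = N p k))"
  using assms
proof (induction ps arbitrary: s)
  case Nil
  define N0 where "N0 h = (SOME k. k \<in> H \<and> s k = s h)" for h
  have "N0 h \<in> H \<and> s (N0 h) = s h" if "h \<in> H" for h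
    unfolding N0_def by (rule someI[of _ h]) (use that in simp)
  moreover have "N0 ` H \<subseteq> (\<lambda>c. SOME k. k \<in> H \<and> s k = c) ` s ` H"
    by (auto simp: N0_def)
  then have "finite (N0 ` H)"
    by (rule finite_subset) (use Nil in simp)
  moreover have "N0 h = N0 k" if "s h = s k" for h k
    using that by (simp add: N0_def)
  ultimately show ?case
    unfolding list.set by blast
next
  case (Cons p ps)
  \<comment> \<open>The lifted colour is a function of the view of \<open>p\<close> alone.\<close>
  define s' where "s' h = set_encode (s ` {k\<in>H. V p k = V p h})" for h
  have refine: "V q h = V q k" if "q \<in> set ps" "h \<in> H" "k \<in> H" "V p h = V p k" for q h k
    using Cons.prems(1) that unfolding sorted_wrt.simps by blast
  have "s' ` H \<subseteq> set_encode ` Pow (s ` H)"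
    by (auto simp: s'_def)
  then have fin': "finite (s' ` H)"
    by (rule finite_subset) (use Cons.prems(3) in simp)
  \<comment> \<open>Equal lifted colours mean that the view class of \<open>k\<close> contains every
    colour found in that of \<open>h\<close>; this makes the choice in \<open>rep\<close>
    possible.\<close>
  have s'D: "\<exists>k'\<in>H. V p k' = V p k \<and> s k' = s h" if "s' k = s' h" "h \<in> H" for h k
  proof -
    have "finite (s ` {k'\<in>H. V p k' = V p x})" for x
      by (rule finite_subset[OF _ Cons.prems(3)]) auto
    then have "s ` {k'\<in>H. V p k' = V p k} = s ` {k'\<in>H. V p k' = V p h}"
      using that(1) by (simp add: s'_def set_encode_eq)
    moreover have "s h \<in> s ` {k'\<in>H. V p k' = V p h}"
      using that(2) by simp
    ultimately have "s h \<in> s ` {k'\<in>H. V p k' = V p k}"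
      by simp
    then show ?thesis by force
  qed
  have "sorted_wrt (\<lambda>p q. \<forall>h\<in>H. \<forall>k\<in>H. V p h = V p k \<longrightarrow> V q h = V q k) ps" "distinct ps"
    using Cons.prems(1,2) by simp_all
  from Cons.IH[OF this fin'] obtain N1 N' where
    N1: "\<forall>h\<in>H. N1 h \<in> H \<and> s' (N1 h) = s' h" and fin1: "finite (N1 ` H)" and
    N1_eq: "\<forall>h\<in>H. \<forall>k\<in>H. s' h = s' k \<longrightarrow> (\<forall>q\<in>set ps. V q h = V q k) \<longrightarrow> N1 h = N1 k" and
    N': "\<forall>q\<in>set ps. finite (N' q ` H) \<and> (\<forall>h\<in>H. N' q h \<in> H \<and> V q (N1 h) = V q (N' q h)) \<and>
       (\<forall>h\<in>H. \<forall>k\<in>H. V q h = V q k \<longrightarrow> N' q h = N' q k)"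
    by (elim exE conjE) (rule that)
  \<comment> \<open>\<open>p\<close> can track \<open>N1\<close> because its view determines both
    the lifted colour and the views of all later processes.\<close>
  define N where "N = N'(p := N1)"
  have N_p: "N p = N1" and N_q: "q \<in> set ps \<Longrightarrow> N q = N' q" for q
    using Cons.prems(2) by (auto simp: N_def)
  define rep where "rep r c = (SOME k. k \<in> H \<and> V p k = V p r \<and> s k = c)" for r c
  \<comment> \<open>\<open>N0 h\<close> looks to \<open>p\<close> like the representative
    \<open>N1 h\<close> but keeps the colour \<open>s h\<close>; it depends only on this pair, which
    takes finitely many values.\<close>
  define N0 where "N0 h = rep (N1 h) (s h)" for h
  have N0: "N0 h \<in> H \<and> V p (N0 h) = V p (N1 h) \<and> s (N0 h) = s h" if "h \<in> H" for h
    unfolding N0_def rep_def by (rule someI_ex) (use N1 s'D that in blast)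
  have "N0 ` H \<subseteq> (\<lambda>(r, c). rep r c) ` (N1 ` H \<times> s ` H)"
    by (auto simp: N0_def)
  then have finN0: "finite (N0 ` H)"
    by (rule finite_subset) (use Cons.prems(3) fin1 in simp)
  have s'_eq: "s' h = s' k" if "V p h = V p k" for h k
    using that by (simp add: s'_def)
  have N0_eq: "N0 h = N0 k"
    if "h \<in> H" "k \<in> H" "s h = s k" "\<forall>q\<in>set (p # ps). V q h = V q k" for h k
  proof -
    have "s' h = s' k"
      by (rule s'_eq) (use that(4) in simp)
    moreover have "\<forall>q\<in>set ps. V q h = V q k"
      using that(4) by simp
    ultimately have "N1 h = N1 k"
      using N1_eq that(1,2) by blast
    then show ?thesis
      using that(3) by (simp add: N0_def)
  qed
  have N_prop: "finite (N q ` H) \<and> (\<forall>h\<in>H. N q h \<in> H \<and> V q (N0 h) = V q (N q h)) \<and>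
       (\<forall>h\<in>H. \<forall>k\<in>H. V q h = V q k \<longrightarrow> N q h = N q k)" if "q \<in> set (p # ps)" for q
  proof (cases "q = p")
    case True
    have "N1 h = N1 k" if "h \<in> H" "k \<in> H" "V p h = V p k" for h k
    proof -
      have "s' h = s' k" "\<forall>q\<in>set ps. V q h = V q k"
        using s'_eq[OF that(3)] refine that by blast+
      then show ?thesis
        using N1_eq that(1,2) by blast
    qed
    then show ?thesis
      unfolding True N_p using N1 N0 fin1 by blast
  next
    case False
    then have q: "q \<in> set ps"
      using that by simp
    have "V q (N0 h) = V q (N' q h)" if "h \<in> H" for h
    proof -
      \<comment> \<open>\<open>N0 h\<close> and \<open>N1 h\<close> agree in the view of
        \<open>p\<close>, hence in the coarser view of \<open>q\<close>.\<close>
      have "V q (N0 h) = V q (N1 h)"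
        by (rule refine[OF q]) (use N0 N1 that in blast)+
      also have "\<dots> = V q (N' q h)"
        using N' q that by blast
      finally show ?thesis .
    qed
    then show ?thesis
      unfolding N_q[OF q] using N' q by blast
  qed
  show ?case
    by (intro exI[of _ N0] exI[of _ N] conjI ballI impI) (use N0 finN0 N0_eq N_prop in blast)+
qed

section \<open>Transducers with states of any type\<close>

text \<open>\<open>finite_state\<close> demands states in \<open>nat\<close>, so the machine is
  carried over along an injection of \<open>K\<close>. Histories can then serve as states.\<close>

lemma finite_state_of_finite_type:
  assumes fin: "finite K" and "k0 \<in> K" and "\<delta> \<in> K \<rightarrow> Pow J \<rightarrow> K"
  shows "finite_state J (\<lambda>h. out (foldl \<delta> k0 h))"
proof -
  obtain e :: "_ \<Rightarrow> nat" where e: "inj_on e K"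
    using finite_imp_inj_to_nat_seg[OF fin] by blast
  define d where "d = the_inv_into K e"
  have d: "d (e k) = k" if "k \<in> K" for k
    using that e by (simp add: d_def the_inv_into_f_f)
  have K: "\<delta> k a \<in> K" if "k \<in> K" "a \<in> Pow J" for k a
    using assms(3) that by blast
  define \<delta>' where "\<delta>' m a = e (\<delta> (d m) a)" for m a
  have "foldl \<delta> k h \<in> K \<and> foldl \<delta>' (e k) h = e (foldl \<delta> k h)"
    if "h \<in> lists (Pow J)" "k \<in> K" for k h
    using that
  proof (induction h arbitrary: k)
    case (Cons a h)
    then have "a \<in> Pow J" "h \<in> lists (Pow J)"
      by simp_all
    then show ?case
      using Cons K by (simp add: \<delta>'_def d)
  qed simp
  then have "out (foldl \<delta> k0 h) = (out \<circ> d) (foldl \<delta>' (e k0) h)" if "h \<in> lists (Pow J)" for h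
    using that assms(2) d by simp
  moreover have "\<delta>' \<in> e ` K \<rightarrow> Pow J \<rightarrow> e ` K"
    using K d by (auto simp: \<delta>'_def)
  ultimately show ?thesis
    unfolding finite_state_def using fin assms(2)
    by (intro exI[of _ "e ` K"] exI[of _ "e k0"] exI[of _ \<delta>'] exI[of _ "out \<circ> d"]) simp
qed


section \<open>Compactness\<close>

text \<open>A diagonal argument in the manner of Koenig's lemma: indices \<open>c n\<close> are
  chosen so that \<open>F (c n)\<close> agrees with infinitely many \<open>F t\<close> on
  \<open>D n\<close>, and successive choices agree on the earlier set. Having infinitely many
  \<open>t\<close> leaves room to take \<open>t\<close> arbitrarily large.\<close>

lemma ex_pointwise_limit_point:
  fixes F :: "nat \<Rightarrow> 'a \<Rightarrow> 'b"
  assumes fin: "\<And>n. finite (D n)" and mono: "\<And>n. D n \<subseteq> D (Suc n)"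
    and vals: "\<And>n x. x \<in> D n \<Longrightarrow> finite (range (\<lambda>t. F t x))"
  shows "\<exists>g. \<forall>n. infinite {t. \<forall>x\<in>D n. F t x = g x}"
proof -
  have pigeonhole: "\<exists>a\<in>T. infinite {t\<in>T. \<forall>x\<in>D n. F t x = F a x}" if "infinite T" for T n
  proof -
    have "(\<lambda>t. restrict (F t) (D n)) ` T \<subseteq> (\<Pi>\<^sub>E x\<in>D n. range (\<lambda>t. F t x))"
      by auto
    moreover have "finite (\<Pi>\<^sub>E x\<in>D n. range (\<lambda>t. F t x))"
      using fin vals by (intro finite_PiE) auto
    ultimately have "finite ((\<lambda>t. restrict (F t) (D n)) ` T)"
      by (rule finite_subset)
    from pigeonhole_infinite[OF that this] obtain a where a: "a \<in> T"
      "infinite {t\<in>T. restrict (F t) (D n) = restrict (F a) (D n)}"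
      by blast
    have "{t\<in>T. restrict (F t) (D n) = restrict (F a) (D n)} \<subseteq>
        {t\<in>T. \<forall>x\<in>D n. F t x = F a x}"
      by (auto dest: fun_cong simp: restrict_def split: if_splits)
    with a show ?thesis
      using finite_subset by blast
  qed
  define P where "P n a \<longleftrightarrow> infinite {t. \<forall>x\<in>D n. F t x = F a x}" for n a
  have "\<exists>c. \<forall>n. P n (c n) \<and> (\<forall>x\<in>D n. F (c (Suc n)) x = F (c n) x)"
  proof (rule dependent_nat_choice)
    show "\<exists>a. P 0 a"
      using pigeonhole[of UNIV 0] by (auto simp: P_def)
  next
    fix a n assume "P n a"
    then obtain b where b: "\<forall>x\<in>D n. F b x = F a x"
      "infinite {t\<in>{t. \<forall>x\<in>D n. F t x = F a x}. \<forall>x\<in>D (Suc n). F t x = F b x}"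
      using pigeonhole[of "{t. \<forall>x\<in>D n. F t x = F a x}" "Suc n"] by (auto simp: P_def)
    have "P (Suc n) b"
      unfolding P_def by (rule infinite_super[OF _ b(2)]) blast
    with b(1) show "\<exists>b. P (Suc n) b \<and> (\<forall>x\<in>D n. F b x = F a x)"
      by blast
  qed
  then obtain c where c: "\<And>n. P n (c n)" "\<And>n x. x \<in> D n \<Longrightarrow> F (c (Suc n)) x = F (c n) x"
    by blast
  \<comment> \<open>The values at \<open>x\<close> are stable from the first \<open>D n\<close>
    containing \<open>x\<close>; outside every \<open>D n\<close> the value is arbitrary.\<close>
  define g where "g x = F (c (LEAST n. x \<in> D n)) x" for x
  have "F (c n) x = g x" if x: "x \<in> D n" for n x
  proof -
    let ?m = "LEAST n. x \<in> D n"
    have "?m \<le> n" "x \<in> D ?m"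
      using x by (auto intro: Least_le LeastI)
    then have "x \<in> D n \<and> F (c n) x = F (c ?m) x"
      by (induction n rule: dec_induct) (use c(2) mono in auto)
    then show ?thesis by (simp add: g_def)
  qed
  then have "infinite {t. \<forall>x\<in>D n. F t x = g x}" for n
    using c(1)[of n] by (simp add: P_def cong: conj_cong)
  then show ?thesis by blast
qed


section \<open>Runs on finite histories\<close>

definition view :: "('p, 'v) arch \<Rightarrow> 'p \<Rightarrow> 'v set list \<Rightarrow> 'v set list" where
  "view A p u = map (\<lambda>a. a \<inter> inp A p) u"

definition next_letter ::
    "('p, 'v) arch \<Rightarrow> ('p, 'v) impl \<Rightarrow> 'v set list \<Rightarrow> 'v set \<Rightarrow> 'v set" where
  "next_letter A f u x = x \<union> (\<Union>p\<in>procs A. f p (view A p u))"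

text \<open>The recursion of \<open>run_prefix\<close>, moved from infinite words to finite
  histories, so that histories can be compared, replaced and extended.\<close>

definition trace :: "('p, 'v) arch \<Rightarrow> ('p, 'v) impl \<Rightarrow> 'v set list \<Rightarrow> 'v set list" where
  "trace A f h = foldl (\<lambda>u x. u @ [next_letter A f u x]) [] h"

lemma trace_Nil [simp]: "trace A f [] = []"
  by (simp add: trace_def)

lemma trace_snoc [simp]: "trace A f (h @ [x]) = trace A f h @ [next_letter A f (trace A f h) x]"
  by (simp add: trace_def)

lemma length_trace [simp]: "length (trace A f h) = length h"
  by (induction h rule: rev_induct) simp_all

lemma view_simps [simp]:
  "view A p [] = []" "view A p (u @ v) = view A p u @ view A p v" "view A p [a] = [a \<inter> inp A p]"
  "length (view A p u) = length u"
  by (simp_all add: view_def)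

lemma view_in_lists [simp]: "view A p u \<in> lists (Pow (inp A p))"
  unfolding view_def lists_eq_set by auto

definition env_hists :: "('p, 'v) arch \<Rightarrow> 'v set list set" where
  "env_hists A = lists (Pow (env_vars A))"

lemma env_hists_simps [simp]:
  "[] \<in> env_hists A" "h @ [x] \<in> env_hists A \<longleftrightarrow> h \<in> env_hists A \<and> x \<subseteq> env_vars A"
  by (auto simp: env_hists_def)

lemma implementations_outp:
  "f \<in> implementations A \<Longrightarrow> p \<in> procs A \<Longrightarrow> f p (view A p u) \<subseteq> outp A p"
  using view_in_lists[of A p u] unfolding implementations_def by blast

context architecture
begin

lemma next_letter_env:
  assumes "f \<in> implementations A" "x \<subseteq> env_vars A" "v \<in> env_vars A"
  shows "v \<in> next_letter A f u x \<longleftrightarrow> v \<in> x"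
  using assms implementations_outp[OF assms(1)]
  unfolding next_letter_def env_vars_def all_outp_def by blast

lemma next_letter_outp:
  assumes f: "f \<in> implementations A" and x: "x \<subseteq> env_vars A" and "p \<in> procs A" "v \<in> outp A p"
  shows "v \<in> next_letter A f u x \<longleftrightarrow> v \<in> f p (view A p u)"
proof -
  have "v \<notin> x"
    using assms by (auto simp: env_vars_def all_outp_def)
  moreover have "q = p" if "q \<in> procs A" "v \<in> f q (view A q u)" for q
    using implementations_outp[OF f that(1), of u] that outp_disjoint[of q p] assms by blast
  ultimately show ?thesis
    unfolding next_letter_def using assms(3) by blast
qed

text \<open>Existence and uniqueness of the induced run replace the definite description by a
  recursion.\<close>

lemma prefix_induced_run:
  assumes f: "f \<in> implementations A" and s: "\<sigma> \<in> env_words A"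
  shows "prefix n (induced_run A f \<sigma>) = trace A f (prefix n \<sigma>)"
proof -
  define w where "w = induced_run A f \<sigma>"
  have w: "is_induced_run A f \<sigma> w"
    using theI'[OF ex1_induced_run[OF f s]] by (simp add: w_def induced_run_def)
  have "prefix n w = trace A f (prefix n \<sigma>)"
  proof (induction n)
    case (Suc n)
    have wn: "w n \<subseteq> all_inp A \<union> all_outp A" "w n \<inter> env_vars A = \<sigma> n"
      and out: "\<And>p. p \<in> procs A \<Longrightarrow> w n \<inter> outp A p = f p (view A p (prefix n w))"
      using w by (simp_all add: is_induced_run_def view_def)
    have "w n = (w n \<inter> env_vars A) \<union> (\<Union>p\<in>procs A. w n \<inter> outp A p)"
      using wn(1) by (auto simp: env_vars_def all_outp_def)
    also have "\<dots> = next_letter A f (prefix n w) (\<sigma> n)"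
      unfolding next_letter_def wn(2) using out by simp
    finally show ?case
      using Suc by (simp add: subsequence_def)
  qed (simp add: subsequence_def)
  then show ?thesis by (simp add: w_def)
qed

lemma prefix_env_word: "\<sigma> \<in> env_words A \<Longrightarrow> prefix n \<sigma> \<in> env_hists A"
  unfolding env_words_def env_hists_def lists_eq_set by auto

lemma env_hist_extend:
  assumes "h \<in> env_hists A"
  shows "h \<frown> (\<lambda>_. {}) \<in> env_words A" "prefix (length h) (h \<frown> (\<lambda>_. {})) = h"
proof -
  have "h ! i \<subseteq> env_vars A" if "i < length h" for i
    using assms nth_mem[OF that] by (auto simp: env_hists_def lists_eq_set)
  then show "h \<frown> (\<lambda>_. {}) \<in> env_words A"
    by (auto simp: env_words_def conc_def)
qed simp

text \<open>Safety enters here: a violation would show as an empty residual after some prefix, and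
  prefixes of runs are traces. Conversely, each history extends to an infinite word.\<close>

lemma all_runs_sat_iff:
  assumes f: "f \<in> implementations A"
  shows "(\<forall>\<sigma>\<in>env_words A. induced_run A f \<sigma> \<Turnstile> \<phi>) \<longleftrightarrow>
    (\<forall>h\<in>env_hists A. residual \<phi> (trace A f h) \<noteq> {})"
proof
  assume l: "\<forall>\<sigma>\<in>env_words A. induced_run A f \<sigma> \<Turnstile> \<phi>"
  show "\<forall>h\<in>env_hists A. residual \<phi> (trace A f h) \<noteq> {}"
  proof
    fix h assume "h \<in> env_hists A"
    note e = env_hist_extend[OF this]
    show "residual \<phi> (trace A f h) \<noteq> {}"
      using residual_prefix_nonempty[of _ \<phi> "length h"] l e
        prefix_induced_run[OF f e(1), of "length h"] by metis
  qed
next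
  assume "\<forall>h\<in>env_hists A. residual \<phi> (trace A f h) \<noteq> {}"
  then show "\<forall>\<sigma>\<in>env_words A. induced_run A f \<sigma> \<Turnstile> \<phi>"
    using sat_if_residuals_nonempty prefix_induced_run[OF f] prefix_env_word by metis
qed

section \<open>Compactness of the set of implementations\<close>

lemma finite_inp: "p \<in> procs A \<Longrightarrow> finite (inp A p)"
  using finite_subset[OF inp_vars finite_vars] .

lemma finite_outp: "p \<in> procs A \<Longrightarrow> finite (outp A p)"
  using finite_subset[OF outp_vars finite_vars] .

lemma finite_env_vars: "finite (env_vars A)"
  using finite_procs finite_inp by (simp add: env_vars_def all_inp_def)

text \<open>A run along \<open>h\<close> consults an implementation only on views shorter than
  \<open>h\<close>, so agreement on finitely many arguments fixes the trace.\<close>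

lemma trace_cong:
  assumes "\<And>p u. p \<in> procs A \<Longrightarrow> u \<in> lists (Pow (inp A p)) \<Longrightarrow> length u < length h \<Longrightarrow> f p u = g p u"
  shows "trace A f h = trace A g h"
  using assms
proof (induction h rule: rev_induct)
  case (snoc x h)
  then have eq: "trace A f h = trace A g h"
    by simp
  have "f p (view A p (trace A g h)) = g p (view A p (trace A g h))" if "p \<in> procs A" for p
    by (rule snoc.prems[OF that]) simp_all
  then have "next_letter A f (trace A f h) x = next_letter A g (trace A g h) x"
    by (simp add: next_letter_def eq)
  then show ?case using eq by simp
qed simp

text \<open>For each \<open>n\<close>, the padded histories of length \<open>n\<close> form a finite
  set that is no counterexample, so some \<open>F n\<close> survives all of them. A pointwise limit
  of the \<open>F n\<close> survives histories of every length.\<close>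

lemma ex_all_runs_sat:
  assumes no: "\<nexists>C. finite_counterexample A \<phi> C"
  shows "\<exists>f\<in>implementations A. \<forall>\<sigma>\<in>env_words A. induced_run A f \<sigma> \<Turnstile> \<phi>"
proof -
  have "\<exists>f\<in>implementations A. \<forall>h\<in>env_hists A. length h = n \<longrightarrow> residual \<phi> (trace A f h) \<noteq> {}" for n
  proof -
    define C where "C = (\<lambda>h. h \<frown> (\<lambda>_. {})) ` {h\<in>env_hists A. length h = n}"
    have "{h\<in>env_hists A. length h = n} = {h. set h \<subseteq> Pow (env_vars A) \<and> length h = n}"
      by (auto simp: env_hists_def lists_eq_set)
    then have "finite C" "C \<subseteq> env_words A"
      using finite_env_vars env_hist_extend(1) by (auto simp: C_def finite_lists_length_eq)
    moreover have "\<not> finite_counterexample A \<phi> C"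
      using no by simp
    ultimately obtain f where f: "f \<in> implementations A" "\<forall>\<sigma>\<in>C. induced_run A f \<sigma> \<Turnstile> \<phi>"
      by (auto simp: finite_counterexample_def)
    have "residual \<phi> (trace A f h) \<noteq> {}" if h: "h \<in> env_hists A" "length h = n" for h
    proof -
      note e = env_hist_extend[OF h(1)]
      have "h \<frown> (\<lambda>_. {}) \<in> C"
        using h by (simp add: C_def)
      then show ?thesis
        using residual_prefix_nonempty[of _ \<phi> "length h"] f(2) e
          prefix_induced_run[OF f(1) e(1), of "length h"] by metis
    qed
    with f(1) show ?thesis by blast
  qed
  then obtain F where F: "\<And>n. F n \<in> implementations A"
    "\<And>n h. h \<in> env_hists A \<Longrightarrow> length h = n \<Longrightarrow> residual \<phi> (trace A (F n) h) \<noteq> {}"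
    by metis
  \<comment> \<open>A finite set containing all arguments that traces along histories of length at
    most \<open>n\<close> consult.\<close>
  define D where "D n = (SIGMA p:procs A. {u. set u \<subseteq> Pow (inp A p) \<and> length u \<le> n})" for n
  have D: "(p, u) \<in> D n \<longleftrightarrow> p \<in> procs A \<and> u \<in> lists (Pow (inp A p)) \<and> length u \<le> n" for p u n
    by (auto simp: D_def lists_eq_set)
  have "finite (D n)" for n
    unfolding D_def using finite_procs finite_inp by (intro finite_SigmaI finite_lists_length_le) auto
  moreover have "D n \<subseteq> D (Suc n)" for n
    by (auto simp: D_def)
  moreover have "finite (range (\<lambda>t. case_prod (F t) x))" if "x \<in> D n" for n x
  proof -
    obtain p u where x: "x = (p, u)" "p \<in> procs A" "u \<in> lists (Pow (inp A p))"
      using \<open>x \<in> D n\<close> D by (cases x) blast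
    have "range (\<lambda>t. case_prod (F t) x) \<subseteq> Pow (outp A p)"
      using F(1) x unfolding implementations_def by fastforce
    then show ?thesis
      by (rule finite_subset) (simp add: finite_outp x(2))
  qed
  ultimately obtain g' where g': "\<And>n. infinite {t. \<forall>x\<in>D n. case_prod (F t) x = g' x}"
    using ex_pointwise_limit_point[of D "\<lambda>t. case_prod (F t)"] by blast
  define g where "g p u = g' (p, u)" for p u
  have g: "\<exists>t\<ge>n. \<forall>p u. (p, u) \<in> D n \<longrightarrow> F t p u = g p u" for n
    using g'[of n] by (fastforce simp: infinite_nat_iff_unbounded_le g_def)
  have "g p u \<in> Pow (outp A p)" if pu: "p \<in> procs A" "u \<in> lists (Pow (inp A p))" for p u
  proof -
    have "(p, u) \<in> D (length u)"
      using pu by (simp add: D)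
    then obtain t where "F t p u = g p u"
      using g[of "length u"] by blast
    then show ?thesis
      using F(1)[of t] pu unfolding implementations_def by force
  qed
  then have gi: "g \<in> implementations A"
    by (auto simp: implementations_def)
  have "residual \<phi> (trace A g h) \<noteq> {}" if h: "h \<in> env_hists A" for h
  proof -
    obtain t where t: "t \<ge> length h" "\<And>p u. (p, u) \<in> D (length h) \<Longrightarrow> F t p u = g p u"
      using g[of "length h"] by blast
    have eq: "trace A g h = trace A (F t) h"
      by (rule trace_cong) (use t(2) D in fastforce)
    \<comment> \<open>\<open>F t\<close> is known to survive histories of length exactly
      \<open>t\<close> only, so \<open>h\<close> is padded to that length; a nonempty residual
      passes down to prefixes.\<close>
    define h' where "h' = h @ replicate (t - length h) {}"
    have "h' \<in> env_hists A" "length h' = t"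
      using h t(1) by (auto simp: h'_def env_hists_def lists_eq_set)
    then have "residual \<phi> (trace A (F t) h') \<noteq> {}"
      by (rule F(2))
    moreover have "\<exists>v. trace A (F t) (h @ k) = trace A (F t) h @ v" for k
    proof (induction k rule: rev_induct)
      case (snoc x k)
      then obtain v where "trace A (F t) (h @ k) = trace A (F t) h @ v"
        by blast
      then show ?case
        using trace_snoc[of A "F t" "h @ k" x] by simp
    qed simp
    then obtain v where "trace A (F t) h' = trace A (F t) h @ v"
      unfolding h'_def by blast
    ultimately show ?thesis
      by (auto simp: eq residual_append)
  qed
  then show ?thesis
    using all_runs_sat_iff[OF gi] gi by blast
qed


section \<open>Informedness\<close>

text \<open>Along paths of these edges, information from the environment can bypass an observer of
  \<open>X\<close>.\<close>

definition hidden_edges :: "'v set \<Rightarrow> ('p \<times> 'p) set" where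
  "hidden_edges X = {(q, r) \<in> edges A. \<not> label A q r \<subseteq> X}"

lemma edgeI:
  assumes "q \<in> nodes A" "r \<in> procs A" "v \<in> node_outp A q" "v \<in> inp A r"
  shows "(q, r) \<in> edges A" "v \<in> label A q r"
  using assms by (auto simp: edges_def label_def)

lemma node_outp_proc: "q \<in> procs A \<Longrightarrow> node_outp A q = outp A q"
  using env_not_proc by (auto simp: node_outp_def)

text \<open>
  If all paths from the environment to \<open>s\<close> use an edge that \<open>p\<close> observes completely, then \<open>p\<close>
  observes a cut and can reconstruct everything behind it.
\<close>

lemma view_refines:
  assumes f: "f \<in> implementations A" and p: "p \<in> procs A"
    and "(env A, s) \<notin> (hidden_edges (inp A p))\<^sup>*" "s \<in> procs A"
    and "h \<in> env_hists A" "k \<in> env_hists A"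
    and "view A p (trace A f h) = view A p (trace A f k)"
  shows "view A s (trace A f h) = view A s (trace A f k)"
  using assms(3-)
proof (induction h arbitrary: k s rule: rev_induct)
  case Nil
  then have "length k = 0"
    by (metis length_trace view_simps(4) list.size(3))
  then show ?case by simp
next
  case (snoc x h)
  have "length k = Suc (length h)"
    using arg_cong[OF snoc.prems(5), of length] by simp
  then obtain k' y where k: "k = k' @ [y]"
    by (metis length_Suc_conv_rev)
  have H: "h \<in> env_hists A" "k' \<in> env_hists A" "x \<subseteq> env_vars A" "y \<subseteq> env_vars A"
    using snoc.prems(3,4) by (simp_all add: k)
  let ?a = "next_letter A f (trace A f h) x" and ?b = "next_letter A f (trace A f k') y"
  have eq: "view A p (trace A f h) = view A p (trace A f k')" "?a \<inter> inp A p = ?b \<inter> inp A p"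
    using snoc.prems(5) by (simp_all add: k)
  have "v \<in> ?a \<longleftrightarrow> v \<in> ?b" if v: "v \<in> inp A s" for v
  proof (cases "v \<in> inp A p")
    case True
    with eq(2) show ?thesis by blast
  next
    case False
    \<comment> \<open>Whoever produces a variable of \<open>s\<close> that \<open>p\<close> does not
      see is itself cut off, as otherwise the edge to \<open>s\<close> would complete a hidden path.
      This also excludes the environment, which reaches itself by the empty path.\<close>
    have hidden: "(env A, q) \<notin> (hidden_edges (inp A p))\<^sup>*"
      if "q \<in> nodes A" "v \<in> node_outp A q" for q
    proof
      assume "(env A, q) \<in> (hidden_edges (inp A p))\<^sup>*"
      moreover have "(q, s) \<in> hidden_edges (inp A p)"
        using edgeI[OF that(1) snoc.prems(2) that(2) v] False by (auto simp: hidden_edges_def)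
      ultimately show False
        using snoc.prems(1) by (meson rtrancl.rtrancl_into_rtrancl)
    qed
    have "v \<notin> env_vars A"
      using hidden[of "env A"] by (auto simp: nodes_def node_outp_def)
    then obtain q where q: "q \<in> procs A" "v \<in> outp A q"
      using v snoc.prems(2) by (auto simp: env_vars_def all_inp_def all_outp_def)
    have "(env A, q) \<notin> (hidden_edges (inp A p))\<^sup>*"
      using hidden[of q] q by (simp add: nodes_def node_outp_proc)
    then have "view A q (trace A f h) = view A q (trace A f k')"
      using q(1) H(1,2) eq(1) by (rule snoc.IH)
    then show ?thesis
      using next_letter_outp[OF f _ q] H by simp
  qed
  then have "?a \<inter> inp A s = ?b \<inter> inp A s"
    by blast
  moreover have "view A s (trace A f h) = view A s (trace A f k')"
    using snoc.IH[OF snoc.prems(1,2) H(1,2) eq(1)] .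
  ultimately show ?case
    by (simp add: k)
qed

text \<open>The path to \<open>p\<close> hidden from \<open>p'\<close> cannot stay hidden from both,
  since \<open>p\<close> sees its last edge. The first edge that the two together see completely
  carries a variable unknown to \<open>p'\<close> and therefore read by \<open>p\<close>; its source
  is \<open>q\<close>.\<close>

lemma ex_fork_branch:
  assumes "(env A, p) \<in> (hidden_edges (inp A p'))\<^sup>*" "p \<in> procs A"
  shows "\<exists>q. (env A, q) \<in> (hidden_edges (inp A p \<union> inp A p'))\<^sup>* \<and> \<not> label A q p \<subseteq> inp A p'"
proof -
  let ?F = "hidden_edges (inp A p \<union> inp A p')"
  have "(env A, p) \<notin> ?F\<^sup>*"
  proof
    assume "(env A, p) \<in> ?F\<^sup>*"
    then show False
      by (rule rtranclE) (use assms(2) env_not_proc in \<open>auto simp: hidden_edges_def label_def\<close>)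
  qed
  moreover have "(env A, z) \<in> ?F\<^sup>* \<or> (\<exists>q. (env A, q) \<in> ?F\<^sup>* \<and> \<not> label A q p \<subseteq> inp A p')"
    if "(env A, z) \<in> (hidden_edges (inp A p'))\<^sup>*" for z
    using that
  proof (induction rule: rtrancl_induct)
    case (step y z)
    then have yz: "(y, z) \<in> edges A" "\<not> label A y z \<subseteq> inp A p'"
      by (auto simp: hidden_edges_def)
    show ?case
    proof (cases "label A y z \<subseteq> inp A p \<union> inp A p'")
      case True
      then have "\<not> label A y p \<subseteq> inp A p'"
        using yz(2) by (auto simp: label_def)
      then show ?thesis
        using step.IH by blast
    next
      case False
      then have "(y, z) \<in> ?F"
        using yz(1) by (simp add: hidden_edges_def)
      then show ?thesis
        using step.IH by (meson rtrancl.rtrancl_into_rtrancl)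
    qed
  qed simp
  ultimately show ?thesis
    using assms(1) by blast
qed

text \<open>\<open>V'\<close> consists of all variables unseen by both processes, and
  \<open>P'\<close> of everything reachable through them. Each process then receives from
  \<open>P'\<close> a variable that the other does not read, which makes the labels
  incomparable.\<close>

lemma information_forkI:
  assumes p: "p \<in> procs A" "p' \<in> procs A" "p \<noteq> p'"
    and reach: "(env A, p) \<in> (hidden_edges (inp A p'))\<^sup>*" "(env A, p') \<in> (hidden_edges (inp A p))\<^sup>*"
  shows "\<exists>P' V'. information_fork A P' V' p p'"
proof -
  define F where "F = hidden_edges (inp A p \<union> inp A p')"
  define W where "W = {q. (env A, q) \<in> F\<^sup>*}"
  define V' where "V' = vars A - (inp A p \<union> inp A p')"
  obtain q where q: "q \<in> W" "\<not> label A q p \<subseteq> inp A p'"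
    using ex_fork_branch[OF reach(1) p(1)] by (auto simp: W_def F_def)
  obtain q' where q': "q' \<in> W" "\<not> label A q' p' \<subseteq> inp A p"
    using ex_fork_branch[OF reach(2) p(2)] by (auto simp: W_def F_def Un_commute)
  have "label A r s \<subseteq> vars A" if "(r, s) \<in> edges A" for r s
    using that inp_vars by (auto simp: edges_def label_def)
  then have F: "F = {(r, s) \<in> edges A. label A r s \<inter> V' \<noteq> {}}"
    unfolding F_def V'_def hidden_edges_def by fast
  have nodes: "v \<in> nodes A" if "v \<in> W" for v
  proof -
    have "(env A, v) \<in> F\<^sup>*"
      using that by (simp add: W_def)
    then show ?thesis
      by (cases rule: rtranclE) (auto simp: nodes_def F_def hidden_edges_def edges_def)
  qed
  \<comment> \<open>An edge into such a process carries nothing outside the two input sets, so it is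
    not in \<open>F\<close>; this keeps \<open>p\<close> and \<open>p'\<close> out of
    \<open>W\<close>.\<close>
  have notin: "r \<notin> W" if "r \<in> procs A" "inp A r \<subseteq> inp A p \<union> inp A p'" for r
  proof
    assume "r \<in> W"
    then have "(env A, r) \<in> F\<^sup>*"
      by (simp add: W_def)
    then show False
      by (rule rtranclE)
        (use that env_not_proc in \<open>auto simp: F_def hidden_edges_def label_def\<close>)
  qed
  have "(env A, v) \<in> (F \<inter> W \<times> W)\<^sup>*" if "v \<in> W" for v
  proof -
    have "(env A, v) \<in> F\<^sup>*"
      using that by (simp add: W_def)
    then show ?thesis
    proof (induction rule: rtrancl_induct)
      case (step y z)
      then have "(y, z) \<in> F \<inter> W \<times> W"
        by (auto simp: W_def intro: rtrancl.rtrancl_into_rtrancl)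
      with step.IH show ?case
        by (rule rtrancl.rtrancl_into_rtrancl)
    qed simp
  qed
  then have "rooted_in (env A) W F"
    by (simp add: rooted_in_def W_def)
  moreover have "(q, p) \<in> edges A" "(q', p') \<in> edges A"
    using q q' p nodes by (auto simp: edges_def)
  moreover have "\<not> label A q p \<subseteq> label A q' p'" "\<not> label A q' p' \<subseteq> label A q p"
    using q(2) q'(2) by (auto simp: label_def)
  moreover have "p \<notin> W" "p' \<notin> W" "W \<subseteq> nodes A" "V' \<subseteq> vars A" "V' \<inter> (inp A p \<union> inp A p') = {}"
    using notin p nodes by (auto simp: V'_def)
  ultimately have "information_fork A W V' p p'"
    unfolding information_fork_def F using q(1) q'(1) p by blast
  then show ?thesis by blast
qed

text \<open>If each of two processes were reachable by a path hidden from the other, there would be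
  a fork. So one of them observes a cut in front of the other, and refinement of views is a total
  preorder.\<close>

lemma weakly_ordered_views_sorted:
  assumes wo: "weakly_ordered A" and f: "f \<in> implementations A"
  shows "\<exists>ps. distinct ps \<and> set ps = procs A \<and>
    sorted_wrt (\<lambda>p q. \<forall>h\<in>env_hists A. \<forall>k\<in>env_hists A.
      view A p (trace A f h) = view A p (trace A f k) \<longrightarrow>
      view A q (trace A f h) = view A q (trace A f k)) ps"
proof (rule ex_sorted_wrt_list)
  show "totalp_on (procs A) (\<lambda>p q. \<forall>h\<in>env_hists A. \<forall>k\<in>env_hists A.
      view A p (trace A f h) = view A p (trace A f k) \<longrightarrow>
      view A q (trace A f h) = view A q (trace A f k))"
  proof (rule totalp_onI)
    fix p q assume pq: "p \<in> procs A" "q \<in> procs A" "p \<noteq> q"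
    then have "(env A, p) \<notin> (hidden_edges (inp A q))\<^sup>* \<or> (env A, q) \<notin> (hidden_edges (inp A p))\<^sup>*"
      using information_forkI wo unfolding weakly_ordered_def by blast
    moreover have "\<forall>h\<in>env_hists A. \<forall>k\<in>env_hists A.
        view A a (trace A f h) = view A a (trace A f k) \<longrightarrow>
        view A b (trace A f h) = view A b (trace A f k)"
      if "(env A, b) \<notin> (hidden_edges (inp A a))\<^sup>*" "a \<in> procs A" "b \<in> procs A" for a b
      by (intro ballI impI) (rule view_refines[OF f that(2,1,3)])
    ultimately show "(\<forall>h\<in>env_hists A. \<forall>k\<in>env_hists A.
        view A p (trace A f h) = view A p (trace A f k) \<longrightarrow>
        view A q (trace A f h) = view A q (trace A f k)) \<or>
      (\<forall>h\<in>env_hists A. \<forall>k\<in>env_hists A.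
        view A q (trace A f h) = view A q (trace A f k) \<longrightarrow>
        view A p (trace A f h) = view A p (trace A f k))"
      using pq(1,2) by metis
  qed
qed (fact finite_procs, rule transp_onI, blast)


section \<open>Finite-state implementations\<close>

text \<open>The states of \<open>p\<close> are the finitely many histories chosen by
  \<open>N p\<close>. On an observation, \<open>p\<close> takes any history whose view continues
  that of its state accordingly and moves to its representative; since \<open>N p\<close> depends on
  the view alone, the choice does not matter.\<close>

lemma realizable_if_all_runs_sat:
  assumes wo: "weakly_ordered A" and f: "f \<in> implementations A"
    and sat: "\<forall>\<sigma>\<in>env_words A. induced_run A f \<sigma> \<Turnstile> \<phi>"
  shows "realizable A \<phi>"
proof -
  let ?H = "env_hists A"
  define V where "V p h = view A p (trace A f h)" for p h
  from weakly_ordered_views_sorted[OF wo f, folded V_def]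
  obtain ps where ps: "distinct ps" "set ps = procs A"
    "sorted_wrt (\<lambda>p q. \<forall>h\<in>?H. \<forall>k\<in>?H. V p h = V p k \<longrightarrow> V q h = V q k) ps"
    by blast
  obtain e :: "'v set word set \<Rightarrow> nat" where e: "inj_on e (range (residual \<phi>))"
    using finite_imp_inj_to_nat_seg[OF finite_residuals] by blast
  define s where "s h = e (residual \<phi> (trace A f h))" for h
  have "s ` ?H \<subseteq> e ` range (residual \<phi>)"
    by (auto simp: s_def)
  then have "finite (s ` ?H)"
    by (rule finite_subset) (simp add: finite_residuals)
  from collapse_views[OF ps(3,1) this, unfolded ps(2)] obtain N0 N where
    N0_all: "\<forall>h\<in>?H. N0 h \<in> ?H \<and> s (N0 h) = s h" and
    N_all: "\<forall>p\<in>procs A. finite (N p ` ?H) \<and> (\<forall>h\<in>?H. N p h \<in> ?H \<and> V p (N0 h) = V p (N p h)) \<and>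
       (\<forall>h\<in>?H. \<forall>k\<in>?H. V p h = V p k \<longrightarrow> N p h = N p k)"
    by (elim exE conjE) (rule that)
  note N0 = N0_all[THEN bspec, THEN conjunct1] N0_all[THEN bspec, THEN conjunct2]
  note N = N_all[THEN bspec, THEN conjunct1]
    N_all[THEN bspec, THEN conjunct2, THEN conjunct1, THEN bspec, THEN conjunct1]
    N_all[THEN bspec, THEN conjunct2, THEN conjunct1, THEN bspec, THEN conjunct2]
    N_all[THEN bspec, THEN conjunct2, THEN conjunct2, THEN bspec, THEN bspec, THEN mp]
  \<comment> \<open>The default \<open>[]\<close> is a history too, so impossible observations still
    lead to a state.\<close>
  define pick where "pick p k a = (if \<exists>h\<in>?H. V p h = V p k @ [a]
      then SOME h. h \<in> ?H \<and> V p h = V p k @ [a] else [])" for p k a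
  have pick: "V p (pick p k a) = V p k @ [a]" if "h \<in> ?H" "V p h = V p k @ [a]" for h p k a
    using that someI_ex[of "\<lambda>h. h \<in> ?H \<and> V p h = V p k @ [a]"] by (auto simp: pick_def)
  have pick_H: "pick p k a \<in> ?H" for p k a
    using someI_ex[of "\<lambda>h. h \<in> ?H \<and> V p h = V p k @ [a]"] by (auto simp: pick_def)
  define \<delta> where "\<delta> p k a = N p (pick p k a)" for p k a
  define st where "st p u = foldl (\<delta> p) (N p []) u" for p u
  define g where "g p u = f p (V p (st p u))" for p u
  have g_impl: "g \<in> implementations A"
    using implementations_outp[OF f] by (simp add: implementations_def g_def V_def Pi_I)
  have fs: "finite_state (inp A p) (g p)" if "p \<in> procs A" for p
    unfolding g_def st_def
    using finite_state_of_finite_type[of "N p ` ?H" "N p []" "\<delta> p" "inp A p" "\<lambda>k. f p (V p k)"]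
      N(1)[OF that] pick_H by (simp add: \<delta>_def Pi_I)
  text \<open>
    The run of \<open>g\<close> is glued from steps of \<open>f\<close>: after every history each process sits at its
    representative of one common history \<open>d\<close> of \<open>f\<close> with the same residual.
  \<close>
  have "\<exists>d\<in>?H. (\<forall>p\<in>procs A. st p (view A p (trace A g h)) = N p d) \<and>
      residual \<phi> (trace A g h) = residual \<phi> (trace A f d)" if "h \<in> ?H" for h
    using that
  proof (induction h rule: rev_induct)
    case Nil
    show ?case
      by (intro bexI[of _ "[]"]) (simp_all add: st_def)
  next
    case (snoc x h)
    then obtain d where d: "d \<in> ?H"
      "\<And>p. p \<in> procs A \<Longrightarrow> st p (view A p (trace A g h)) = N p d"
      "residual \<phi> (trace A g h) = residual \<phi> (trace A f d)"
      by auto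
    \<comment> \<open>\<open>N0 d\<close> looks to every process \<open>p\<close> like its state
      \<open>N p d\<close>, so all outputs of \<open>g\<close> come from this one history and
      jointly form a step of \<open>f\<close>.\<close>
    let ?l = "next_letter A f (trace A f (N0 d)) x"
    have d'_H: "N0 d @ [x] \<in> ?H"
      using snoc.prems N0(1) d(1) by simp
    have out: "g p (view A p (trace A g h)) = f p (view A p (trace A f (N0 d)))"
      if "p \<in> procs A" for p
      unfolding g_def d(2)[OF that] N(3)[OF that d(1), symmetric] by (simp add: V_def)
    have l: "next_letter A g (trace A g h) x = ?l"
      unfolding next_letter_def using out by simp
    have "st p (view A p (trace A g (h @ [x]))) = N p (N0 d @ [x])" if p: "p \<in> procs A" for p
    proof -
      have V: "V p (N0 d @ [x]) = V p (N p d) @ [?l \<inter> inp A p]"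
        using N(3)[OF p d(1)] by (simp add: V_def)
      have "st p (view A p (trace A g (h @ [x]))) = \<delta> p (N p d) (?l \<inter> inp A p)"
        using d(2)[OF p] by (simp add: l st_def)
      \<comment> \<open>\<open>pick\<close> returns a history with the same view for
        \<open>p\<close> as \<open>N0 d @ [x]\<close>, hence with the same representative.\<close>
      also have "\<dots> = N p (N0 d @ [x])"
        unfolding \<delta>_def using pick[OF d'_H V] V by (intro N(4)[OF p pick_H d'_H]) simp
      finally show ?thesis .
    qed
    \<comment> \<open>The colour encodes the residual injectively, and the residual of an extended
      word depends only on the residual before and the added letter.\<close>
    moreover have "residual \<phi> (trace A f d) = residual \<phi> (trace A f (N0 d))"
      using N0(2)[OF d(1)] e by (simp add: s_def inj_on_eq_iff)
    then have "residual \<phi> (trace A g (h @ [x])) = residual \<phi> (trace A f (N0 d @ [x]))"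
      by (simp add: l residual_append d(3))
    ultimately show ?case
      using d'_H by blast
  qed
  then have "\<forall>h\<in>?H. residual \<phi> (trace A g h) \<noteq> {}"
    using sat unfolding all_runs_sat_iff[OF f] by metis
  then have "\<forall>\<sigma>\<in>env_words A. induced_run A g \<sigma> \<Turnstile> \<phi>"
    using all_runs_sat_iff[OF g_impl] by blast
  then show ?thesis
    unfolding realizable_def using g_impl fs by blast
qed

end

theorem theorem5p6:
  fixes A :: "('p, 'v) arch" and \<phi> :: "'v safe_ltl"
  assumes "architecture A"
    and "weakly_ordered A"
    and "atoms \<phi> \<subseteq> all_inp A \<union> all_outp A"
  shows "\<not> realizable A \<phi> \<longleftrightarrow> (\<exists>C. finite_counterexample A \<phi> C)"
proof
  \<comment> \<open>By contraposition: without a finite counterexample, compactness gives an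
    implementation of possibly infinite state, which is then made finite-state.\<close>
  assume "\<not> realizable A \<phi>"
  then show "\<exists>C. finite_counterexample A \<phi> C"
    using architecture.ex_all_runs_sat[OF assms(1), of \<phi>]
      architecture.realizable_if_all_runs_sat[OF assms(1,2)] by blast
next
  assume "\<exists>C. finite_counterexample A \<phi> C"
  then show "\<not> realizable A \<phi>"
    unfolding finite_counterexample_def realizable_def by blast
qed

end
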